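(* Let $G$ be a torsion free Abelian group. If $E$ is a finite subset of $G$ containing at least $2$ elements, then $E$ does not have the discrete Pompeiu property with respect to the family of all translations of $G$.
   Context: Let $\mathcal{G}$ be a family of bijections of a set $X$ onto itself. A nonempty finite set $K\subset X$ has the discrete Pompeiu property with respect to $\mathcal{G}$ if the following holds: whenever $f\colon X\to\mathbb{C}$ is a function such that $\sum_{x\in K}f(\phi(x))=0$ for every $\phi\in\mathcal{G}$, then $f\equiv 0$. The translations of an Abelian group $G$ are the maps $x\mapsto x+g$ with $g\in G$. *)

theory Defs
  imports Complex_Main "HOL-Algebra.Bij"
begin

text \<open>
  A map on \<open>X\<close> is only specified on \<open>X\<close>: the family \<open>\<F>\<close> is meant to consist of elements of
  \<^term>\<open>Bij X\<close>, and a function \<open>X \<rightarrow> \<complex>\<close> is represented by a total function whose values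
  outside \<open>X\<close> are irrelevant. That \<open>K\<close> is a nonempty finite subset of \<open>X\<close> is a precondition
  for the use of the notion rather than a conjunct of the definition, so that the negation does
  not become true for trivial reasons.
\<close>

definition discrete_pompeiu :: "'a set \<Rightarrow> ('a \<Rightarrow> 'a) set \<Rightarrow> 'a set \<Rightarrow> bool" where
  "discrete_pompeiu X \<F> K \<longleftrightarrow>
     (\<forall>f :: 'a \<Rightarrow> complex.
        (\<forall>\<phi>\<in>\<F>. (\<Sum>x\<in>K. f (\<phi> x)) = 0) \<longrightarrow> (\<forall>x\<in>X. f x = 0))"

definition group_translations :: "('a, 'b) monoid_scheme \<Rightarrow> ('a \<Rightarrow> 'a) set" where
  "group_translations G = {(\<lambda>x\<in>carrier G. x \<otimes>\<^bsub>G\<^esub> g) | g. g \<in> carrier G}"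

definition torsion_free :: "('a, 'b) monoid_scheme \<Rightarrow> bool" where
  "torsion_free G \<longleftrightarrow>
     (\<forall>x\<in>carrier G. \<forall>n::nat. n > 0 \<longrightarrow> x [^]\<^bsub>G\<^esub> n = \<one>\<^bsub>G\<^esub> \<longrightarrow> x = \<one>\<^bsub>G\<^esub>)"

lemma (in group) group_translations_subset_Bij: "group_translations G \<subseteq> Bij (carrier G)"
proof -
  have "bij_betw (\<lambda>x. x \<otimes> g) (carrier G) (carrier G)" if g: "g \<in> carrier G" for g
    by (rule bij_betw_byWitness[where f' = "\<lambda>x. x \<otimes> inv g"]) (use g in \<open>auto simp: m_assoc\<close>)
  then show ?thesis
    by (auto simp: group_translations_def Bij_def cong: bij_betw_cong)
qed

end

theory Submission
  imports Defs "HOL-Library.Function_Algebras"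
begin

text \<open>
  Let \<open>\<delta>\<^sub>x\<close> be the indicator function of \<open>x\<close> and let \<open>V\<close> be the complex span of the indicator
  functions of the translates \<open>E \<otimes> g\<close>. If \<open>L\<close> is a linear functional that vanishes on \<open>V\<close>, then
  \<open>f x = L \<delta>\<^sub>x\<close> has sum zero over every translate of \<open>E\<close>. If in addition \<open>L \<delta>\<^sub>1 = 1\<close>, then \<open>f\<close> is
  not zero, so \<open>f\<close> refutes the Pompeiu property. Such an \<open>L\<close> exists as soon as
  \<open>\<delta>\<^sub>1 \<notin> V\<close> (\<open>functional_vanishing_on_span\<close>).

  In terms of the group ring \<open>\<complex>[G]\<close>, the condition \<open>\<delta>\<^sub>1 \<notin> V\<close> says that the sum of the elements of
  \<open>E\<close> is not a unit. This holds because a torsion free Abelian group can be linearly ordered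
  (\<open>total_cone_exists\<close>): for a finite nonempty set \<open>S\<close> of translations, both the product
  of the least elements of \<open>E\<close> and \<open>S\<close> and the product of their greatest elements have only one
  representation as a product of an element of \<open>E\<close> and an element of \<open>S\<close>
  (\<open>two_unique_products\<close>). No cancellation can take place at these two points, and they are distinct
  because \<open>E\<close> has at least two elements. Hence a nonzero combination of translates of the
  indicator function of \<open>E\<close> is nonzero at two points at least, and so it is not \<open>\<delta>\<^sub>1\<close>.
\<close>

section \<open>Linear orders on torsion free Abelian groups\<close>

text \<open>
  The set of nonnegative elements of a translation invariant partial order:
  \<open>x \<le> y\<close> corresponds to \<open>y \<otimes> inv x \<in> P\<close>.
\<close>

definition positive_cone :: "('a, 'b) monoid_scheme \<Rightarrow> 'a set \<Rightarrow> bool" where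
  "positive_cone G P \<longleftrightarrow> P \<subseteq> carrier G \<and> \<one>\<^bsub>G\<^esub> \<in> P \<and> (\<forall>x\<in>P. \<forall>y\<in>P. x \<otimes>\<^bsub>G\<^esub> y \<in> P) \<and>
     (\<forall>x\<in>P. inv\<^bsub>G\<^esub> x \<in> P \<longrightarrow> x = \<one>\<^bsub>G\<^esub>)"

definition total_cone :: "('a, 'b) monoid_scheme \<Rightarrow> 'a set \<Rightarrow> bool" where
  "total_cone G P \<longleftrightarrow> positive_cone G P \<and> (\<forall>x\<in>carrier G. x \<in> P \<or> inv\<^bsub>G\<^esub> x \<in> P)"

context comm_group
begin

lemma positive_cone_pow:
  assumes "positive_cone G P" "x \<in> P"
  shows "x [^] (n::nat) \<in> P"
  using assms by (induction n) (auto simp: positive_cone_def)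

text \<open>
  The elements \<open>p \<otimes> a\<^sup>n\<close> always form a submonoid. What can fail is antisymmetry: a relation
  \<open>(p \<otimes> a\<^sup>n) \<otimes> (q \<otimes> a\<^sup>m) = \<one>\<close> with \<open>n + m > 0\<close> makes \<open>p \<otimes> q\<close> a negative power of \<open>a\<close>
  that belongs to \<open>P\<close>. For \<open>n + m = 0\<close> the relation reduces to the antisymmetry of \<open>P\<close>.
\<close>

lemma positive_cone_adjoin:
  assumes P: "positive_cone G P" and a: "a \<in> carrier G"
    and neg: "\<And>n::nat. n > 0 \<Longrightarrow> inv (a [^] n) \<notin> P"
  shows "positive_cone G {p \<otimes> a [^] n | p n. p \<in> P \<and> n \<in> (UNIV :: nat set)}"
    (is "positive_cone G ?Q")
proof -
  have PG: "P \<subseteq> carrier G" and one: "\<one> \<in> P" and mult: "\<And>x y. x \<in> P \<Longrightarrow> y \<in> P \<Longrightarrow> x \<otimes> y \<in> P"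
    and antisym: "\<And>x. x \<in> P \<Longrightarrow> inv x \<in> P \<Longrightarrow> x = \<one>"
    using P by (auto simp: positive_cone_def)
  have prod: "(p \<otimes> a [^] n) \<otimes> (q \<otimes> a [^] m) = (p \<otimes> q) \<otimes> a [^] (n + m)"
    if "p \<in> P" "q \<in> P" for p q and n m :: nat
  proof -
    have "p \<in> carrier G" "q \<in> carrier G" using that PG by auto
    then show ?thesis using a by (simp add: nat_pow_mult [symmetric] m_ac)
  qed
  have "x = \<one>" if "x \<in> ?Q" "inv x \<in> ?Q" for x
  proof -
    obtain p n q m where x: "x = p \<otimes> a [^] (n::nat)" "inv x = q \<otimes> a [^] (m::nat)"
      and pq: "p \<in> P" "q \<in> P"
      using \<open>x \<in> ?Q\<close> \<open>inv x \<in> ?Q\<close> by blast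
    have "x \<in> carrier G" using x(1) pq PG a by auto
    then have "x \<otimes> inv x = \<one>" by simp
    then have eq: "(p \<otimes> q) \<otimes> a [^] (n + m) = \<one>"
      unfolding x(2) unfolding x(1) prod [OF pq] .
    have pqG: "p \<otimes> q \<in> carrier G" using mult pq PG by blast
    have "p \<otimes> q = inv (a [^] (n + m))"
      using inv_equality [OF eq] a pqG by simp
    then have nm: "n + m = 0"
      using neg [of "n + m"] mult [OF pq] by (cases "n + m = 0") simp_all
    have G: "p \<in> carrier G" "q \<in> carrier G" using pq PG by auto
    then have "p \<otimes> q = \<one>" using eq nm pqG by simp
    then have "inv p = q" using G by (intro inv_equality) (simp_all add: m_comm)
    then have "p = \<one>" using antisym [of p] pq by simp
    then show ?thesis using x nm by simp
  qed
  moreover have "\<one> \<in> ?Q"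
    using one by (intro CollectI exI [of _ \<one>] exI [of _ 0]) auto
  moreover have "x \<otimes> y \<in> ?Q" if xy: "x \<in> ?Q" "y \<in> ?Q" for x y
  proof -
    obtain p n q m where "x = p \<otimes> a [^] (n::nat)" "y = q \<otimes> a [^] (m::nat)" "p \<in> P" "q \<in> P"
      using xy by blast
    then show ?thesis
      using prod mult by (intro CollectI exI [of _ "p \<otimes> q"] exI [of _ "n + m"]) simp
  qed
  moreover have "?Q \<subseteq> carrier G" using PG a by auto
  ultimately show ?thesis unfolding positive_cone_def by (intro conjI ballI impI)
qed

lemma positive_cone_Union_chain:
  assumes "C \<noteq> {}" "subset.chain (Collect (positive_cone G)) C"
  shows "positive_cone G (\<Union>C)"
proof -
  have cone: "positive_cone G P" if "P \<in> C" for P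
    using assms(2) that by (auto simp: subset.chain_def)
  have common: "\<exists>R\<in>C. x \<in> R \<and> y \<in> R" if xy: "x \<in> \<Union>C" "y \<in> \<Union>C" for x y
  proof -
    obtain P Q where "P \<in> C" "Q \<in> C" "x \<in> P" "y \<in> Q" using xy by blast
    moreover from this have "P \<subseteq> Q \<or> Q \<subseteq> P"
      using assms(2) by (simp add: subset_chain_def)
    ultimately show ?thesis by blast
  qed
  have "x \<otimes> y \<in> \<Union>C" if "x \<in> \<Union>C" "y \<in> \<Union>C" for x y
    using common [OF that] cone by (auto simp: positive_cone_def)
  moreover have "x = \<one>" if "x \<in> \<Union>C" "inv x \<in> \<Union>C" for x
    using common [OF that] cone by (auto simp: positive_cone_def)
  moreover have "\<Union>C \<subseteq> carrier G"
    using cone by (intro Union_least) (simp add: positive_cone_def)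
  moreover have "\<one> \<in> \<Union>C"
    using cone assms(1) by (auto simp: positive_cone_def)
  ultimately show ?thesis unfolding positive_cone_def by (intro conjI ballI impI)
qed

text \<open>
  A maximal cone is total: if neither \<open>a\<close> nor \<open>inv a\<close> belonged to it, then by maximality neither
  could be adjoined, so a positive and a negative power of \<open>a\<close> would lie in the cone. For a common
  multiple \<open>k\<close> of the exponents, both \<open>a\<^sup>k\<close> and its inverse lie in the cone, so \<open>a\<^sup>k = \<one>\<close>, and
  torsion freeness gives \<open>a = \<one>\<close>, which does belong to the cone.
\<close>

lemma total_cone_exists:
  assumes tf: "torsion_free G"
  obtains P where "total_cone G P"
proof -
  have "positive_cone G {\<one>}" by (simp add: positive_cone_def)
  then have "Collect (positive_cone G) \<noteq> {}" by blast
  then have "\<exists>P\<in>Collect (positive_cone G). \<forall>Q\<in>Collect (positive_cone G). P \<subseteq> Q \<longrightarrow> Q = P"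
    by (rule subset_Zorn_nonempty) (simp add: positive_cone_Union_chain)
  then obtain P where P: "positive_cone G P"
    and max: "\<And>Q. positive_cone G Q \<Longrightarrow> P \<subseteq> Q \<Longrightarrow> Q = P"
    by blast
  have PG: "P \<subseteq> carrier G" and one: "\<one> \<in> P"
    and antisym: "\<And>x. x \<in> P \<Longrightarrow> inv x \<in> P \<Longrightarrow> x = \<one>"
    using P by (auto simp: positive_cone_def)
  have negative_power: "\<exists>n::nat. n > 0 \<and> inv (b [^] n) \<in> P" if b: "b \<in> carrier G" "b \<notin> P" for b
  proof (rule ccontr)
    assume "\<not> ?thesis"
    then have "positive_cone G {p \<otimes> b [^] n | p n. p \<in> P \<and> n \<in> (UNIV :: nat set)}"
      (is "positive_cone G ?Q")
      using positive_cone_adjoin [OF P b(1)] by blast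
    moreover have "P \<subseteq> ?Q"
    proof
      fix p assume "p \<in> P"
      then show "p \<in> ?Q"
        using PG by (intro CollectI exI [of _ p] exI [of _ "0::nat"]) auto
    qed
    ultimately have "?Q = P" by (rule max)
    moreover have "b \<in> ?Q"
      using one b by (intro CollectI exI [of _ \<one>] exI [of _ 1]) auto
    ultimately show False using b by blast
  qed
  have "a \<in> P \<or> inv a \<in> P" if a: "a \<in> carrier G" for a
  proof (rule ccontr)
    assume not: "\<not> ?thesis"
    then have "a \<notin> P" "inv a \<notin> P" by simp_all
    obtain n :: nat where n: "n > 0" "inv (a [^] n) \<in> P"
      using negative_power [OF a \<open>a \<notin> P\<close>] by blast
    obtain m :: nat where m: "m > 0" "inv (inv a [^] m) \<in> P"
      using negative_power [OF inv_closed [OF a] \<open>inv a \<notin> P\<close>] by blast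
    have "inv (inv a [^] m) = a [^] m" using a by (simp add: nat_pow_inv)
    then have "(a [^] m) [^] n \<in> P"
      using positive_cone_pow [OF P m(2), of n] by simp
    then have "a [^] (m * n) \<in> P" using a by (simp only: nat_pow_pow)
    moreover have "inv (a [^] n) [^] m = inv (a [^] (m * n))"
      using a nat_pow_inv [of "a [^] n" m] nat_pow_pow [OF a, of n m] by (simp add: mult.commute)
    then have "inv (a [^] (m * n)) \<in> P"
      using positive_cone_pow [OF P n(2), of m] by simp
    ultimately have "a [^] (m * n) = \<one>" by (rule antisym)
    moreover have "m * n > 0" using m(1) n(1) by simp
    ultimately have "a = \<one>" using tf a unfolding torsion_free_def by blast
    then show False using \<open>a \<notin> P\<close> one by simp
  qed
  then show thesis using P that by (auto simp: total_cone_def)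
qed

lemma total_cone_inverse:
  assumes "total_cone G P"
  shows "total_cone G ((\<lambda>x. inv x) ` P)"
proof -
  have PG: "P \<subseteq> carrier G" and one: "\<one> \<in> P" and mult: "\<And>x y. x \<in> P \<Longrightarrow> y \<in> P \<Longrightarrow> x \<otimes> y \<in> P"
    and antisym: "\<And>x. x \<in> P \<Longrightarrow> inv x \<in> P \<Longrightarrow> x = \<one>"
    and total: "\<And>x. x \<in> carrier G \<Longrightarrow> x \<in> P \<or> inv x \<in> P"
    using assms by (auto simp: total_cone_def positive_cone_def)
  have mem: "x \<in> (\<lambda>x. inv x) ` P \<longleftrightarrow> inv x \<in> P" if "x \<in> carrier G" for x
    using that PG by (metis (no_types, opaque_lifting) image_iff inv_inv subsetD)
  have sub: "(\<lambda>x. inv x) ` P \<subseteq> carrier G" using PG by auto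
  have "x \<otimes> y \<in> (\<lambda>x. inv x) ` P" if "x \<in> (\<lambda>x. inv x) ` P" "y \<in> (\<lambda>x. inv x) ` P" for x y
  proof -
    have "x \<in> carrier G" "y \<in> carrier G" using that sub by auto
    then show ?thesis using that mem mult by (simp add: inv_mult)
  qed
  moreover have "x = \<one>" if "x \<in> (\<lambda>x. inv x) ` P" "inv x \<in> (\<lambda>x. inv x) ` P" for x
  proof -
    have "x \<in> carrier G" using that sub by auto
    then show ?thesis using that mem antisym by (metis inv_closed inv_inv)
  qed
  moreover have "\<one> \<in> (\<lambda>x. inv x) ` P" using mem one by simp
  moreover have "x \<in> (\<lambda>x. inv x) ` P \<or> inv x \<in> (\<lambda>x. inv x) ` P" if "x \<in> carrier G" for x
    using total [OF that] that mem [of x] mem [of "inv x"] by auto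
  ultimately show ?thesis
    unfolding total_cone_def positive_cone_def using sub by (intro conjI ballI impI)
qed

section \<open>Products with a unique representation\<close>

lemma total_cone_least:
  assumes P: "total_cone G P" and "finite A" "A \<noteq> {}" "A \<subseteq> carrier G"
  shows "\<exists>m\<in>A. \<forall>a\<in>A. a \<otimes> inv m \<in> P"
  using assms(2-4)
proof (induction A rule: finite_ne_induct)
  case (singleton x)
  then show ?case using P by (auto simp: total_cone_def positive_cone_def)
next
  case (insert x A)
  then obtain m where m: "m \<in> A" "\<And>a. a \<in> A \<Longrightarrow> a \<otimes> inv m \<in> P" by auto
  have x: "x \<in> carrier G" and AG: "A \<subseteq> carrier G" and mG: "m \<in> carrier G"
    using insert m by auto
  have one: "\<one> \<in> P" and mult: "\<And>x y. x \<in> P \<Longrightarrow> y \<in> P \<Longrightarrow> x \<otimes> y \<in> P"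
    using P by (auto simp: total_cone_def positive_cone_def)
  have "x \<otimes> inv m \<in> P \<or> inv (x \<otimes> inv m) \<in> P"
    using P x mG by (auto simp: total_cone_def)
  then show ?case
  proof
    assume "x \<otimes> inv m \<in> P"
    then show ?thesis using m by auto
  next
    assume "inv (x \<otimes> inv m) \<in> P"
    then have mx: "m \<otimes> inv x \<in> P" using x mG by (simp add: inv_mult m_comm)
    have "a \<otimes> inv x \<in> P" if "a \<in> A" for a
    proof -
      have a: "a \<in> carrier G" using that AG by auto
      have "a \<otimes> inv x = (a \<otimes> inv m) \<otimes> (m \<otimes> inv x)"
        using a x mG by (metis inv_closed inv_solve_right m_assoc m_closed)
      then show ?thesis using m(2) [OF that] mx mult by simp
    qed
    then show ?thesis using one x by auto
  qed
qed

text \<open>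
  For the least elements \<open>a\<close> and \<open>b\<close>, an equation \<open>a' \<otimes> b' = a \<otimes> b\<close> says that the nonnegative
  elements \<open>a' \<otimes> inv a\<close> and \<open>b' \<otimes> inv b\<close> are inverse to each other, so both are \<open>\<one>\<close>.
  That \<open>a\<close> is least is kept in the conclusion in order to compare the products obtained from
  two different orders.
\<close>

lemma total_cone_unique_product:
  assumes P: "total_cone G P"
    and A: "finite A" "A \<noteq> {}" "A \<subseteq> carrier G" and B: "finite B" "B \<noteq> {}" "B \<subseteq> carrier G"
  obtains a b where "a \<in> A" "b \<in> B" "\<And>a'. a' \<in> A \<Longrightarrow> a' \<otimes> inv a \<in> P"
    "\<And>a' b'. a' \<in> A \<Longrightarrow> b' \<in> B \<Longrightarrow> a' \<otimes> b' = a \<otimes> b \<Longrightarrow> a' = a \<and> b' = b"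
proof -
  obtain a where a: "a \<in> A" "\<And>a'. a' \<in> A \<Longrightarrow> a' \<otimes> inv a \<in> P"
    using total_cone_least [OF P A] by blast
  obtain b where b: "b \<in> B" "\<And>b'. b' \<in> B \<Longrightarrow> b' \<otimes> inv b \<in> P"
    using total_cone_least [OF P B] by blast
  have "a' = a \<and> b' = b" if a': "a' \<in> A" and b': "b' \<in> B" and eq: "a' \<otimes> b' = a \<otimes> b" for a' b'
  proof -
    have G: "a \<in> carrier G" "a' \<in> carrier G" "b \<in> carrier G" "b' \<in> carrier G"
      using a b a' b' A B by auto
    have "(b' \<otimes> inv b) \<otimes> (a' \<otimes> inv a) = (a' \<otimes> b') \<otimes> inv (a \<otimes> b)"
      using G by (simp add: inv_mult m_ac)
    also have "\<dots> = \<one>" using eq G by simp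
    finally have "inv (a' \<otimes> inv a) = b' \<otimes> inv b" using G by (intro inv_equality) auto
    then have "a' \<otimes> inv a = \<one>"
      using P a(2) [OF a'] b(2) [OF b'] by (auto simp: total_cone_def positive_cone_def)
    then have "a' = a" using G by (metis inv_closed inv_equality inv_inv)
    then show ?thesis using eq G by simp
  qed
  then show thesis using that a b by blast
qed

text \<open>
  Reversing the order turns least into greatest elements. The two products differ because the
  least and the greatest element of \<open>A\<close> do.
\<close>

lemma two_unique_products:
  assumes tf: "torsion_free G"
    and A: "card A \<ge> 2" "A \<subseteq> carrier G" and B: "finite B" "B \<noteq> {}" "B \<subseteq> carrier G"
  obtains a b c d where "a \<in> A" "b \<in> B" "c \<in> A" "d \<in> B" "a \<otimes> b \<noteq> c \<otimes> d"
    "\<And>a' b'. a' \<in> A \<Longrightarrow> b' \<in> B \<Longrightarrow> a' \<otimes> b' = a \<otimes> b \<Longrightarrow> a' = a \<and> b' = b"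
    "\<And>a' b'. a' \<in> A \<Longrightarrow> b' \<in> B \<Longrightarrow> a' \<otimes> b' = c \<otimes> d \<Longrightarrow> a' = c \<and> b' = d"
proof -
  have fin: "finite A" "A \<noteq> {}" using A(1) card.infinite by fastforce+
  obtain P where P: "total_cone G P" using total_cone_exists [OF tf] .
  obtain a b where ab: "a \<in> A" "b \<in> B" "\<And>a'. a' \<in> A \<Longrightarrow> a' \<otimes> inv a \<in> P"
    and ab_unique: "\<And>a' b'. a' \<in> A \<Longrightarrow> b' \<in> B \<Longrightarrow> a' \<otimes> b' = a \<otimes> b \<Longrightarrow> a' = a \<and> b' = b"
    using total_cone_unique_product [OF P fin A(2) B] by metis
  obtain c d where cd: "c \<in> A" "d \<in> B" "\<And>a'. a' \<in> A \<Longrightarrow> a' \<otimes> inv c \<in> (\<lambda>x. inv x) ` P"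
    and cd_unique: "\<And>a' b'. a' \<in> A \<Longrightarrow> b' \<in> B \<Longrightarrow> a' \<otimes> b' = c \<otimes> d \<Longrightarrow> a' = c \<and> b' = d"
    using total_cone_unique_product [OF total_cone_inverse [OF P] fin A(2) B] by metis
  have PG: "P \<subseteq> carrier G" and antisym: "\<And>x. x \<in> P \<Longrightarrow> inv x \<in> P \<Longrightarrow> x = \<one>"
    using P by (auto simp: total_cone_def positive_cone_def)
  have "a \<otimes> b \<noteq> c \<otimes> d"
  proof
    assume "a \<otimes> b = c \<otimes> d"
    then have ac: "a = c" using ab cd cd_unique by blast
    have "a' = a" if "a' \<in> A" for a'
    proof -
      have G: "a \<in> carrier G" "a' \<in> carrier G" using that ab A by auto
      have "inv (a' \<otimes> inv a) \<in> P"
        using cd(3) [OF that] ac PG by auto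
      then have "a' \<otimes> inv a = \<one>" using ab(3) [OF that] antisym by blast
      then show ?thesis using G by (metis inv_closed inv_equality inv_inv)
    qed
    then have "A \<subseteq> {a}" by blast
    then have "card A \<le> 1" using card_mono [of "{a}" A] by simp
    then show False using A by simp
  qed
  then show thesis using that ab cd ab_unique cd_unique by blast
qed

end

section \<open>Combinations of translates of an indicator function\<close>

text \<open>
  A maximal independent part of \<open>B\<close> stays independent when \<open>v\<close> is added, so a functional can be
  prescribed on it.
\<close>

lemma (in vector_space) functional_vanishing_on_span:
  assumes v: "v \<notin> span B"
  obtains L where "Vector_Spaces.linear scale (*) L" "\<And>x. x \<in> B \<Longrightarrow> L x = 0" "L v = 1"
proof -
  interpret target: vector_space "(*) :: 'a \<Rightarrow> 'a \<Rightarrow> 'a"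
    by standard (simp_all add: algebra_simps)
  interpret pair: vector_space_pair scale "(*) :: 'a \<Rightarrow> 'a \<Rightarrow> 'a" ..
  obtain C where C: "C \<subseteq> B" "independent C" "B \<subseteq> span C"
    using maximal_independent_subset .
  have "v \<notin> span C" using v C span_mono by blast
  then have "independent (insert v C)" using C by (intro independent_insertI)
  then obtain L where L: "Vector_Spaces.linear scale (*) L"
    and L_eq: "\<And>x. x \<in> insert v C \<Longrightarrow> L x = (if x = v then 1 else 0)"
    using pair.linear_independent_extend [of "insert v C" "\<lambda>x. if x = v then 1 else 0"] by blast
  have "v \<notin> C" using \<open>v \<notin> span C\<close> span_base by blast
  then have "L x = 0" if "x \<in> C" for x using L_eq that by auto
  then have "L x = 0" if "x \<in> B" for x
    using pair.linear_eq_0_on_span [OF L] C that by blast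
  then show thesis using that L L_eq by simp
qed

definition point_mass :: "'a \<Rightarrow> 'a \<Rightarrow> complex" where
  "point_mass x = (\<lambda>y. of_bool (y = x))"

definition translate_indicator :: "('a, 'b) monoid_scheme \<Rightarrow> 'a set \<Rightarrow> 'a \<Rightarrow> 'a \<Rightarrow> complex" where
  "translate_indicator G E g = (\<Sum>e\<in>E. point_mass (e \<otimes>\<^bsub>G\<^esub> g))"

abbreviation scale_fun :: "complex \<Rightarrow> ('a \<Rightarrow> complex) \<Rightarrow> 'a \<Rightarrow> complex" where
  "scale_fun c f \<equiv> (\<lambda>x. c * f x)"

interpretation fun_space: vector_space scale_fun
  by standard (auto simp: fun_eq_iff algebra_simps)

lemma sum_fun_apply: "(\<Sum>i\<in>I. f i) x = (\<Sum>i\<in>I. f i x :: complex)"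
  by (induction I rule: infinite_finite_induct) auto

text \<open>At a product with a unique representation only one term of the combination survives.\<close>

lemma combination_at_unique_product:
  assumes "finite E" "finite S" "e \<in> E" "s \<in> S"
    and unique: "\<And>e' s'. e' \<in> E \<Longrightarrow> s' \<in> S \<Longrightarrow> e' \<otimes>\<^bsub>G\<^esub> s' = e \<otimes>\<^bsub>G\<^esub> s \<Longrightarrow> e' = e \<and> s' = s"
  shows "(\<Sum>g\<in>S. scale_fun (c g) (translate_indicator G E g)) (e \<otimes>\<^bsub>G\<^esub> s) = c s"
proof -
  have "translate_indicator G E g (e \<otimes>\<^bsub>G\<^esub> s) = of_bool (g = s)" if "g \<in> S" for g
  proof -
    have "translate_indicator G E g (e \<otimes>\<^bsub>G\<^esub> s) = (\<Sum>e'\<in>E. of_bool (e \<otimes>\<^bsub>G\<^esub> s = e' \<otimes>\<^bsub>G\<^esub> g))"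
      by (simp add: translate_indicator_def point_mass_def sum_fun_apply)
    also have "\<dots> = (\<Sum>e'\<in>E. if e' = e then of_bool (g = s) else 0)"
    proof (intro sum.cong refl)
      fix e' assume "e' \<in> E"
      then have "e \<otimes>\<^bsub>G\<^esub> s = e' \<otimes>\<^bsub>G\<^esub> g \<longleftrightarrow> e' = e \<and> g = s"
        using unique [of e' g] \<open>g \<in> S\<close> by auto
      then show "of_bool (e \<otimes>\<^bsub>G\<^esub> s = e' \<otimes>\<^bsub>G\<^esub> g) = (if e' = e then of_bool (g = s) else (0::complex))"
        by simp
    qed
    finally show ?thesis using assms by simp
  qed
  then have "(\<Sum>g\<in>S. scale_fun (c g) (translate_indicator G E g)) (e \<otimes>\<^bsub>G\<^esub> s)
      = (\<Sum>g\<in>S. if g = s then c g else 0)"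
    unfolding sum_fun_apply by (intro sum.cong) auto
  then show ?thesis using assms by simp
qed

text \<open>
  A combination with nonzero coefficients survives at two distinct points, a point mass only at one.
\<close>

lemma point_mass_notin_span_translates:
  fixes G (structure)
  assumes "comm_group G" and tf: "torsion_free G"
    and E: "E \<subseteq> carrier G" "finite E" "card E \<ge> 2"
  shows "point_mass \<one> \<notin> fun_space.span (translate_indicator G E ` carrier G)"
proof
  interpret comm_group G by fact
  let ?t = "translate_indicator G E"
  assume "point_mass \<one> \<in> fun_space.span (?t ` carrier G)"
  then obtain T r where T: "finite T" "T \<subseteq> ?t ` carrier G"
    and eq: "point_mass \<one> = (\<Sum>v\<in>T. scale_fun (r v) v)"
    by (auto simp: fun_space.span_explicit)
  obtain U where U: "U \<subseteq> carrier G" "inj_on ?t U" "T = ?t ` U"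
    using T(2) by (auto simp: subset_image_inj)
  have finU: "finite U" using U T finite_imageD by blast
  define c where "c g = r (?t g)" for g
  \<comment> \<open>Zero coefficients must go: the extreme elements of the index set have to contribute.\<close>
  define S where "S = {g \<in> U. c g \<noteq> 0}"
  have S: "finite S" "S \<subseteq> carrier G" using U finU by (auto simp: S_def)
  have "point_mass \<one> = (\<Sum>g\<in>U. scale_fun (c g) (?t g))"
    unfolding eq U(3) by (simp add: sum.reindex [OF U(2)] c_def)
  also have "\<dots> = (\<Sum>g\<in>S. scale_fun (c g) (?t g))"
    using finU by (intro sum.mono_neutral_right) (auto simp: S_def fun_eq_iff)
  finally have comb: "point_mass \<one> = (\<Sum>g\<in>S. scale_fun (c g) (?t g))" .
  have "S \<noteq> {}"
  proof
    assume "S = {}"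
    then have "point_mass \<one> \<one> = 0" using comb by simp
    then show False by (simp add: point_mass_def)
  qed
  then obtain a b a' b' where ab: "a \<in> E" "b \<in> S" "a' \<in> E" "b' \<in> S" and ne: "a \<otimes> b \<noteq> a' \<otimes> b'"
    and u: "\<And>x y. x \<in> E \<Longrightarrow> y \<in> S \<Longrightarrow> x \<otimes> y = a \<otimes> b \<Longrightarrow> x = a \<and> y = b"
    and u': "\<And>x y. x \<in> E \<Longrightarrow> y \<in> S \<Longrightarrow> x \<otimes> y = a' \<otimes> b' \<Longrightarrow> x = a' \<and> y = b'"
    by (rule two_unique_products [OF tf E(3) E(1) S(1) _ S(2)]) (rule that, assumption+)
  have "point_mass \<one> (a \<otimes> b) = c b" "point_mass \<one> (a' \<otimes> b') = c b'"
    unfolding comb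
    by (rule combination_at_unique_product [OF E(2) S(1) ab(1,2) u],
        assumption+, rule combination_at_unique_product [OF E(2) S(1) ab(3,4) u'], assumption+)
  moreover have "c b \<noteq> 0" "c b' \<noteq> 0" using ab by (simp_all add: S_def)
  ultimately have "a \<otimes> b = \<one>" "a' \<otimes> b' = \<one>"
    unfolding point_mass_def of_bool_def by presburger+
  then show False using ne by simp
qed

theorem proposition1p1:
  fixes G :: "('a, 'b) monoid_scheme" and E :: "'a set"
  assumes "comm_group G"
    and "torsion_free G"
    and "E \<subseteq> carrier G"
    and "finite E"
    and "card E \<ge> 2"
  shows "\<not> discrete_pompeiu (carrier G) (group_translations G) E"
proof
  assume pompeiu: "discrete_pompeiu (carrier G) (group_translations G) E"
  interpret comm_group G by fact
  obtain L where L: "Vector_Spaces.linear scale_fun (*) L"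
    and L0: "\<And>g. g \<in> carrier G \<Longrightarrow> L (translate_indicator G E g) = 0"
    and L1: "L (point_mass \<one>\<^bsub>G\<^esub>) = 1"
    by (rule fun_space.functional_vanishing_on_span
          [OF point_mass_notin_span_translates [OF assms]]) (rule that, assumption, simp_all)
  interpret L: Vector_Spaces.linear scale_fun "(*)" L by fact
  have "(\<Sum>x\<in>E. L (point_mass (\<phi> x))) = 0" if \<phi>_in: "\<phi> \<in> group_translations G" for \<phi>
  proof -
    obtain g where g: "g \<in> carrier G" and \<phi>: "\<phi> = (\<lambda>x\<in>carrier G. x \<otimes>\<^bsub>G\<^esub> g)"
      using \<phi>_in by (auto simp: group_translations_def)
    have "(\<Sum>x\<in>E. L (point_mass (\<phi> x))) = (\<Sum>x\<in>E. L (point_mass (x \<otimes>\<^bsub>G\<^esub> g)))"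
      using assms(3) by (intro sum.cong) (auto simp: \<phi>)
    also have "\<dots> = L (translate_indicator G E g)"
      by (simp add: translate_indicator_def L.sum)
    finally show ?thesis using L0 g by simp
  qed
  then have "\<forall>x\<in>carrier G. L (point_mass x) = 0"
    using pompeiu [unfolded discrete_pompeiu_def, THEN spec, of "\<lambda>x. L (point_mass x)"] by simp
  then have "L (point_mass \<one>\<^bsub>G\<^esub>) = 0" by simp
  then show False using L1 by simp
qed

end
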